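(* Let $d\ge 2$ be an integer, and suppose that for every positive integer $n$ there are given $n$ integers $r_1(n),\dots,r_n(n)$ such that $$\min_{i=1,\dots,n}\frac{r_i(n)}{n^{d-2}}\to\infty\quad\text{as } n\to\infty.$$ Denote by $\Lambda^d(n,r)$ the set of $d$-dimensional $(0,1)$-matrices of order $n$ such that, for each $i\in\{1,\dots,n\}$, the number of ones in the $i$-th hyperplane is not greater than $r_i(n)$. Put $F(x)=(\lceil x\rceil!)^{1/\lceil x\rceil}$ for real $x>0$. Then $$\max_{A\in\Lambda^d(n,r)}\operatorname{per}A\leq (n!)^{d-2}\,e^{o(n)}\prod_{i=1}^n F\left(\frac{r_i(n)}{n^{d-2}}\right)\quad\text{as } n\to\infty;$$ that is, there is a sequence of reals $\varepsilon(n)\to 0$ (depending on $d$ and on the numbers $r_i(n)$) such that for all sufficiently large $n$ the inequality holds with $e^{o(n)}$ replaced by $e^{\varepsilon(n)n}$.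
   Context: Let $I_n^d=\{(\alpha_1,\dots,\alpha_d):\alpha_i\in\{1,\dots,n\}\}$. A $d$-dimensional matrix $A$ of order $n$ is a real array $(a_\alpha)_{\alpha\in I_n^d}$; it is a $(0,1)$-matrix if every entry is $0$ or $1$. The $i$-th hyperplane of $A$ is the set of entries $a_\alpha$ with first index $\alpha_1=i$. A diagonal of $A$ is a set of $n$ indices $\{\alpha^1,\dots,\alpha^n\}\subset I_n^d$ such that any two distinct ones differ in all $d$ positions (Hamming distance $d$). The permanent of $A$ is $\operatorname{per}A=\sum_{p}\prod_{\alpha\in p}a_\alpha$, the sum over all diagonals $p$ of $A$. *)

theory Defs
  imports Complex_Main "HOL-Library.FuncSet"
begin

text \<open>Order and dimension are values, not types, because the order tends to infinity in the
  result: multi-indices and matrices are extensional functions (\<open>undefined\<close> off their domain),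
  so that each mathematical object has exactly one representative.\<close>

definition multi_indices :: "nat \<Rightarrow> nat \<Rightarrow> (nat \<Rightarrow> nat) set" where
  "multi_indices d n = {1..d} \<rightarrow>\<^sub>E {1..n}"

type_synonym multi_matrix = "(nat \<Rightarrow> nat) \<Rightarrow> real"

definition multi_matrices :: "nat \<Rightarrow> nat \<Rightarrow> multi_matrix set" where
  "multi_matrices d n = multi_indices d n \<rightarrow>\<^sub>E UNIV"

definition zero_one_matrix :: "nat \<Rightarrow> nat \<Rightarrow> multi_matrix \<Rightarrow> bool" where
  "zero_one_matrix d n A \<longleftrightarrow>
     A \<in> multi_matrices d n \<and> (\<forall>\<alpha>\<in>multi_indices d n. A \<alpha> = 0 \<or> A \<alpha> = 1)"

text \<open>A hyperplane is given by its index positions rather than by its entries,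
  since distinct positions may carry equal entries.\<close>

definition hyperplane :: "nat \<Rightarrow> nat \<Rightarrow> nat \<Rightarrow> (nat \<Rightarrow> nat) set" where
  "hyperplane d n i = {\<alpha> \<in> multi_indices d n. \<alpha> 1 = i}"

definition diagonals :: "nat \<Rightarrow> nat \<Rightarrow> (nat \<Rightarrow> nat) set set" where
  "diagonals d n = {p. p \<subseteq> multi_indices d n \<and> card p = n \<and>
     (\<forall>\<alpha>\<in>p. \<forall>\<beta>\<in>p. \<alpha> \<noteq> \<beta> \<longrightarrow> (\<forall>k\<in>{1..d}. \<alpha> k \<noteq> \<beta> k))}"

definition per :: "nat \<Rightarrow> nat \<Rightarrow> multi_matrix \<Rightarrow> real" where
  "per d n A = (\<Sum>p\<in>diagonals d n. \<Prod>\<alpha>\<in>p. A \<alpha>)"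

definition Lambda :: "nat \<Rightarrow> nat \<Rightarrow> (nat \<Rightarrow> int) \<Rightarrow> multi_matrix set" where
  "Lambda d n r = {A. zero_one_matrix d n A \<and>
     (\<forall>i\<in>{1..n}. int (card {\<alpha> \<in> hyperplane d n i. A \<alpha> = 1}) \<le> r i)}"

definition F_root :: "real \<Rightarrow> real" where
  "F_root x = (fact (nat \<lceil>x\<rceil>)) powr (1 / of_int \<lceil>x\<rceil>)"

text \<open>The next facts make \<^term>\<open>Max (per d n ` Lambda d n r)\<close> a genuine maximum whenever
  all bounds are nonnegative.\<close>

lemma finite_multi_indices: "finite (multi_indices d n)"
  unfolding multi_indices_def by (intro finite_PiE) auto

lemma finite_Lambda: "finite (Lambda d n r)"
proof (rule finite_subset)
  show "Lambda d n r \<subseteq> multi_indices d n \<rightarrow>\<^sub>E {0, 1}"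
    unfolding Lambda_def zero_one_matrix_def multi_matrices_def PiE_def Pi_def by blast
  show "finite (multi_indices d n \<rightarrow>\<^sub>E {0, 1::real})"
    by (intro finite_PiE finite_multi_indices) auto
qed

lemma Lambda_nonempty:
  assumes "\<And>i. i \<in> {1..n} \<Longrightarrow> r i \<ge> 0"
  shows "Lambda d n r \<noteq> {}"
proof -
  define Z :: multi_matrix where "Z = restrict (\<lambda>_. 0) (multi_indices d n)"
  have no_ones: "{\<alpha> \<in> hyperplane d n i. Z \<alpha> = 1} = {}" for i
    by (auto simp: Z_def hyperplane_def)
  have "zero_one_matrix d n Z"
    by (auto simp: Z_def zero_one_matrix_def multi_matrices_def)
  then have "Z \<in> Lambda d n r"
    unfolding Lambda_def mem_Collect_eq no_ones using assms by simp
  then show ?thesis by blast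
qed

end

theory Submission imports Defs begin

text \<open>A discrete version of Radhakrishnan's entropy argument. Give every hyperplane (row) a random
  time in \<open>{1..m}\<close> and fill the rows in decreasing order of time. If \<open>N\<^sub>i(p)\<close> counts
  the ones of row \<open>i\<close> that remain available when a diagonal \<open>p\<close> is followed, then
  \<open>\<Sum>\<^sub>p \<Prod>\<^sub>i 1 / N\<^sub>i(p) \<le> 1\<close>, as uniform choices define a subprobability on
  diagonals; dropping the constraints between rows of equal time only enlarges \<open>N\<^sub>i\<close>. Given
  that row \<open>i\<close> has time \<open>u\<close>, a one survives with probability \<open>(u/m)\<^bsup>d-1\<^esup>\<close> unless
  it is one of at most \<open>d\<^sup>2 n\<^bsup>d-2\<^esup>\<close> degenerate ones, so Jensen's inequality gives
  \<open>ln (per A) \<le> \<Sum>\<^sub>i (1/m) \<Sum>\<^sub>u ln (r\<^sub>i (u/m)\<^bsup>d-1\<^esup> + d\<^sup>2 n\<^bsup>d-2\<^esup>)\<close>. With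
  \<open>m\<close> fixed and \<open>r\<^sub>i / n\<^bsup>d-2\<^esup> \<rightarrow> \<infinity>\<close> the \<open>i\<close>-th term is \<open>ln r\<^sub>i - (d - 1)\<close> up
  to an error that is small for large \<open>m\<close>, and this is at most
  \<open>(d - 2) (ln n!) / n + ln F(r\<^sub>i / n\<^bsup>d-2\<^esup>)\<close> since \<open>ln k! \<ge> k ln k - k\<close>.\<close>

section \<open>Sequential choices and random times\<close>

text \<open>Reveal the values \<open>ev f i\<close> in decreasing order of \<open>t\<close>,
  choosing each uniformly among those still possible; the product is at most the probability of
  arriving at \<open>f\<close>. Ignoring the choices made at equal times only enlarges the counts,
  so an upper bound \<open>c\<close> suffices.\<close>

lemma sum_prod_inverse_choices_le_1:
  fixes t :: "'i \<Rightarrow> 'b::linorder" and ev :: "'f \<Rightarrow> 'i \<Rightarrow> 'v" and c :: "'f \<Rightarrow> 'i \<Rightarrow> real"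
  assumes "finite I" "finite F"
    and "\<And>f g. f \<in> F \<Longrightarrow> g \<in> F \<Longrightarrow> (\<And>i. i \<in> I \<Longrightarrow> ev f i = ev g i) \<Longrightarrow> f = g"
    and "\<And>f i. f \<in> F \<Longrightarrow> i \<in> I \<Longrightarrow>
      real (card ((\<lambda>g. ev g i) ` {g \<in> F. \<forall>j\<in>I. t i < t j \<longrightarrow> ev g j = ev f j})) \<le> c f i"
  shows "(\<Sum>f\<in>F. \<Prod>i\<in>I. 1 / c f i) \<le> 1"
  using assms
proof (induction I arbitrary: F rule: finite_ranking_induct[where f = t])
  case empty
  then have "card F \<le> 1"
    by (auto simp: card_le_Suc0_iff_eq)
  then show ?case by simp
next
  case (insert x S)
  show ?case
  \<comment> \<open>\<open>finite_ranking_induct\<close> makes \<open>t x\<close> maximal but does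
    not exclude \<open>x \<in> S\<close>.\<close>
  proof (cases "x \<in> S")
    case True
    then have eq: "insert x S = S" by blast
    show ?thesis
      using insert.prems unfolding eq by (rule insert.IH)
  next
    case False
    define V where "V = (\<lambda>g. ev g x) ` F"
    have fin: "finite V" using insert.prems(1) by (simp add: V_def)
    have nonneg: "0 \<le> (\<Prod>i\<in>S. 1 / c f i)" if "f \<in> F" for f
    proof (intro prod_nonneg ballI)
      fix i assume "i \<in> S"
      then show "0 \<le> 1 / c f i"
        using insert.prems(3)[OF that, of i] by (smt (verit) insertI2 divide_nonneg_nonneg of_nat_0_le_iff)
    qed
    have first: "real (card V) \<le> c f x" if "f \<in> F" for f
    proof -
      \<comment> \<open>No index has a larger time than \<open>x\<close>, so the condition is
        vacuous and all of \<open>F\<close> competes.\<close>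
      have "{g \<in> F. \<forall>j\<in>insert x S. t x < t j \<longrightarrow> ev g j = ev f j} = F"
        using insert.hyps(2) by force
      then show ?thesis
        using insert.prems(3)[OF that, of x] by (simp add: V_def)
    qed
    have fibre: "(\<Sum>f | f \<in> F \<and> ev f x = v. \<Prod>i\<in>S. 1 / c f i) \<le> 1" for v
    proof (rule insert.IH)
      show "finite {f \<in> F. ev f x = v}" using insert.prems(1) by simp
      show "f = g" if "f \<in> {f \<in> F. ev f x = v}" "g \<in> {f \<in> F. ev f x = v}"
        "\<And>i. i \<in> S \<Longrightarrow> ev f i = ev g i" for f g
        using that by (intro insert.prems(2)) auto
      fix f i assume f: "f \<in> {f \<in> F. ev f x = v}" and i: "i \<in> S"
      \<comment> \<open>All members of the fibre agree at \<open>x\<close>, so the extra condition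
        at \<open>x\<close> excludes none of them.\<close>
      have "card ((\<lambda>g. ev g i) ` {g \<in> {f \<in> F. ev f x = v}. \<forall>j\<in>S. t i < t j \<longrightarrow> ev g j = ev f j})
        \<le> card ((\<lambda>g. ev g i) ` {g \<in> F. \<forall>j\<in>insert x S. t i < t j \<longrightarrow> ev g j = ev f j})"
        using f insert.prems(1) by (intro card_mono image_mono) auto
      also have "real \<dots> \<le> c f i"
        using insert.prems(3)[of f i] f i by simp
      finally show "real (card ((\<lambda>g. ev g i) `
          {g \<in> {f \<in> F. ev f x = v}. \<forall>j\<in>S. t i < t j \<longrightarrow> ev g j = ev f j})) \<le> c f i"
        by simp
    qed
    have "(\<Sum>f\<in>F. \<Prod>i\<in>insert x S. 1 / c f i) = (\<Sum>f\<in>F. 1 / c f x * (\<Prod>i\<in>S. 1 / c f i))"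
      using insert.hyps(1) False by simp
    also have "\<dots> \<le> (\<Sum>f\<in>F. 1 / real (card V) * (\<Prod>i\<in>S. 1 / c f i))"
    proof (intro sum_mono mult_right_mono nonneg)
      fix f assume "f \<in> F"
      moreover from this have "card V > 0"
        using fin by (auto simp: V_def card_gt_0_iff)
      ultimately show "1 / c f x \<le> 1 / real (card V)"
        using first[of f] by (intro divide_left_mono) auto
    qed
    also have "\<dots> = 1 / real (card V) * (\<Sum>v\<in>V. \<Sum>f | f \<in> F \<and> ev f x = v. \<Prod>i\<in>S. 1 / c f i)"
      unfolding V_def sum_distrib_left[symmetric] sum.image_gen[OF insert.prems(1), where g="\<lambda>g. ev g x", symmetric]
      by (rule refl)
    also have "\<dots> \<le> 1 / real (card V) * (\<Sum>v\<in>V. 1)"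
      by (intro mult_left_mono sum_mono fibre) auto
    also have "\<dots> \<le> 1"
      by simp
    finally show ?thesis .
  qed
qed

text \<open>The set is a product box: given \<open>t i = u\<close>, the other times are independent
  and uniform, and each time in \<open>K\<close> is at most \<open>u\<close> with probability
  \<open>u / m\<close>.\<close>

lemma card_bounded_functions:
  fixes u m :: nat
  assumes "finite I" "i \<in> I" "K \<subseteq> I - {i}" "u \<in> {1..m}"
  shows "real (card {t \<in> I \<rightarrow>\<^sub>E {1..m}. t i = u \<and> (\<forall>j\<in>K. t j \<le> u)})
    = real m ^ (card I - 1) * (real u / real m) ^ card K"
proof -
  have fin: "finite K" using assms finite_subset by blast
  define B where "B = (\<lambda>j. if j = i then {u} else if j \<in> K then {1..u} else {1..m})"
  have "{t \<in> I \<rightarrow>\<^sub>E {1..m}. t i = u \<and> (\<forall>j\<in>K. t j \<le> u)} = Pi\<^sub>E I B"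
  proof (intro set_eqI iffI)
    fix t assume "t \<in> {t \<in> I \<rightarrow>\<^sub>E {1..m}. t i = u \<and> (\<forall>j\<in>K. t j \<le> u)}"
    then show "t \<in> Pi\<^sub>E I B"
      by (auto simp: B_def PiE_iff)
  next
    fix t assume t: "t \<in> Pi\<^sub>E I B"
    then have "t j \<in> B j" if "j \<in> I" for j using that by (auto simp: PiE_iff)
    then have "t j \<in> {1..m}" "t i = u" "j \<in> K \<Longrightarrow> t j \<le> u" if "j \<in> I" for j
      using that assms(2-4) by (fastforce simp: B_def split: if_splits)+
    with t assms(2,3) show "t \<in> {t \<in> I \<rightarrow>\<^sub>E {1..m}. t i = u \<and> (\<forall>j\<in>K. t j \<le> u)}"
      by (auto simp: PiE_iff)
  qed
  then have "card {t \<in> I \<rightarrow>\<^sub>E {1..m}. t i = u \<and> (\<forall>j\<in>K. t j \<le> u)} = (\<Prod>j\<in>I. card (B j))"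
    using assms(1) by (simp add: card_PiE)
  also have "\<dots> = (\<Prod>j\<in>I - {i}. if j \<in> K then u else m)"
    using assms(1,2) by (subst prod.remove[of _ i]) (auto simp: B_def split: if_splits intro!: prod.cong)
  also have "\<dots> = u ^ card K * m ^ card (I - {i} - K)"
    using assms by (subst prod.If_cases) (auto simp: Diff_eq Int_absorb1 inf.absorb2)
  also have "card (I - {i} - K) = card I - 1 - card K"
    using assms fin by (simp add: card_Diff_subset)
  finally have *: "card {t \<in> I \<rightarrow>\<^sub>E {1..m}. t i = u \<and> (\<forall>j\<in>K. t j \<le> u)}
    = u ^ card K * m ^ (card I - 1 - card K)" .
  have "card K \<le> card I - 1"
    using card_mono[OF _ assms(3)] assms by simp
  then obtain e where e: "card I - 1 = card K + e"
    using le_iff_add by blast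
  show ?thesis
    unfolding * e using assms(4) by (simp add: power_divide power_add)
qed

section \<open>Diagonals as bijections between coordinates\<close>

lemma diagonal_bij:
  assumes "p \<in> diagonals d n" "k \<in> {1..d}"
  shows "bij_betw (\<lambda>\<alpha>. \<alpha> k) p {1..n}"
proof -
  have p: "p \<subseteq> multi_indices d n" "card p = n"
    using assms(1) by (auto simp: diagonals_def)
  have inj: "inj_on (\<lambda>\<alpha>. \<alpha> k) p"
    using assms unfolding diagonals_def inj_on_def by blast
  have "(\<lambda>\<alpha>. \<alpha> k) ` p \<subseteq> {1..n}"
    using p(1) assms(2) by (auto simp: multi_indices_def PiE_iff)
  then have "(\<lambda>\<alpha>. \<alpha> k) ` p = {1..n}"
    by (rule card_subset_eq[rotated]) (use card_image[OF inj] p(2) in auto)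
  with inj show ?thesis by (simp add: bij_betw_def)
qed

text \<open>Meaningful when \<open>p\<close> is a diagonal and \<open>v\<close> lies in
  \<open>{1..n}\<close>, where the inverse exists by \<open>diagonal_bij\<close>. With
  \<open>k = 1\<close> it lists the diagonal row by row, the form in which it is revealed
  later.\<close>

definition element_at :: "(nat \<Rightarrow> nat) set \<Rightarrow> nat \<Rightarrow> nat \<Rightarrow> (nat \<Rightarrow> nat)" where
  "element_at p k v = the_inv_into p (\<lambda>\<alpha>. \<alpha> k) v"

lemma element_at:
  assumes "p \<in> diagonals d n" "k \<in> {1..d}"
  shows "v \<in> {1..n} \<Longrightarrow> element_at p k v \<in> p"
    and "v \<in> {1..n} \<Longrightarrow> element_at p k v k = v"
    and "\<alpha> \<in> p \<Longrightarrow> element_at p k (\<alpha> k) = \<alpha>"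
proof -
  have inj: "inj_on (\<lambda>\<alpha>. \<alpha> k) p" and img: "(\<lambda>\<alpha>. \<alpha> k) ` p = {1..n}"
    using diagonal_bij[OF assms] by (simp_all add: bij_betw_def)
  show "v \<in> {1..n} \<Longrightarrow> element_at p k v \<in> p"
    using the_inv_into_into[OF inj _ subset_refl] unfolding img element_at_def .
  show "v \<in> {1..n} \<Longrightarrow> element_at p k v k = v"
    using f_the_inv_into_f[OF inj] unfolding img element_at_def .
  show "\<alpha> \<in> p \<Longrightarrow> element_at p k (\<alpha> k) = \<alpha>"
    using the_inv_into_f_f[OF inj] unfolding element_at_def .
qed

lemma per_zero_one:
  assumes "zero_one_matrix d n A"
  shows "per d n A = card {p \<in> diagonals d n. \<forall>\<alpha>\<in>p. A \<alpha> = 1}"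
proof -
  have fin: "finite (diagonals d n)"
    by (rule finite_subset[of _ "Pow (multi_indices d n)"])
       (auto simp: diagonals_def finite_multi_indices)
  have "(\<Prod>\<alpha>\<in>p. A \<alpha>) = of_bool (\<forall>\<alpha>\<in>p. A \<alpha> = 1)" if "p \<in> diagonals d n" for p
  proof -
    have "p \<subseteq> multi_indices d n" using that by (auto simp: diagonals_def)
    then have "finite p" "\<forall>\<alpha>\<in>p. A \<alpha> = 0 \<or> A \<alpha> = 1"
      using assms finite_subset[OF _ finite_multi_indices] by (auto simp: zero_one_matrix_def)
    then show ?thesis by (induction p) auto
  qed
  then have "per d n A = (\<Sum>p\<in>diagonals d n. of_bool (\<forall>\<alpha>\<in>p. A \<alpha> = 1))"
    by (simp add: per_def)
  also have "\<dots> = card {p \<in> diagonals d n. \<forall>\<alpha>\<in>p. A \<alpha> = 1}"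
    using fin by (simp add: Int_def)
  finally show ?thesis .
qed

section \<open>Positions of a hyperplane and the rows that block them\<close>

text \<open>The first coordinate is fixed to \<open>i\<close> and the \<open>l\<close>-th is a
  function of the \<open>k\<close>-th, so the other \<open>d - 2\<close> coordinates determine the
  position. The case \<open>k = 1\<close> is included.\<close>

lemma card_hyperplane_graph_le:
  assumes "k \<in> {1..d}" "l \<in> {1..d}" "k \<noteq> l" "l \<noteq> 1"
  shows "card {\<beta> \<in> hyperplane d n i. \<beta> l = \<phi> (\<beta> k)} \<le> n ^ (d - 2)"
proof -
  let ?R = "{1..d} - {1, l}"
  have "inj_on (\<lambda>\<beta>. restrict \<beta> ?R) {\<beta> \<in> hyperplane d n i. \<beta> l = \<phi> (\<beta> k)}"
  proof (rule inj_onI)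
    fix \<beta> \<gamma> :: "nat \<Rightarrow> nat"
    assume b: "\<beta> \<in> {\<beta> \<in> hyperplane d n i. \<beta> l = \<phi> (\<beta> k)}" and
      c: "\<gamma> \<in> {\<beta> \<in> hyperplane d n i. \<beta> l = \<phi> (\<beta> k)}" and
      eq: "restrict \<beta> ?R = restrict \<gamma> ?R"
    have agree: "\<beta> j = \<gamma> j" if "j \<in> {1..d}" "j \<noteq> l" for j
      using fun_cong[OF eq, of j] that b c by (cases "j = 1") (auto simp: hyperplane_def)
    moreover have "\<beta> l = \<gamma> l"
      using agree[OF assms(1,3)] b c by simp
    ultimately show "\<beta> = \<gamma>"
      using b c agree
      by (intro PiE_ext[of _ "{1..d}" "\<lambda>_. {1..n}"]) (auto simp: hyperplane_def multi_indices_def, metis)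
  qed
  then have "card {\<beta> \<in> hyperplane d n i. \<beta> l = \<phi> (\<beta> k)} \<le> card (?R \<rightarrow>\<^sub>E {1..n})"
    by (rule card_inj_on_le) (auto simp: hyperplane_def multi_indices_def PiE_iff split: if_splits intro!: finite_PiE)
  also have "\<dots> = n ^ (d - 2)"
    using assms by (simp add: card_PiE card_Diff_subset numeral_2_eq_2)
  finally show ?thesis .
qed

text \<open>A position \<open>\<beta>\<close> of a hyperplane is no longer available to a diagonal that agrees with
  \<open>p\<close> in one of these rows, unless it is the element of \<open>p\<close> in that row.\<close>

definition blocking_rows :: "nat \<Rightarrow> (nat \<Rightarrow> nat) set \<Rightarrow> (nat \<Rightarrow> nat) \<Rightarrow> nat set" where
  "blocking_rows d p \<beta> = (\<lambda>k. element_at p k (\<beta> k) 1) ` {2..d}"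

text \<open>A coincidence among the blocking rows, or with row \<open>i\<close>, determines one coordinate of
  \<open>\<beta>\<close> from another.\<close>

lemma card_degenerate_le:
  assumes p: "p \<in> diagonals d n" and i: "i \<in> {1..n}" and d: "d \<ge> 2"
  shows "card {\<beta> \<in> hyperplane d n i. card (blocking_rows d p \<beta> - {i}) \<noteq> d - 1} \<le> d\<^sup>2 * n ^ (d - 2)"
proof -
  \<comment> \<open>Pairs with \<open>k = 1\<close> account for a blocking row equal to
    \<open>i\<close>, since \<open>\<beta> 1 = i\<close>.\<close>
  define P where "P = {(k, l). k \<in> {1..d} \<and> l \<in> {1..d} \<and> k \<noteq> l \<and> l \<noteq> 1}"
  define G where "G = (\<lambda>(k, l). {\<beta> \<in> hyperplane d n i. \<beta> l = element_at p k (\<beta> k) l})"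
  have P: "P \<subseteq> {1..d} \<times> {1..d}" by (auto simp: P_def)
  then have finP: "finite P" by (rule finite_subset) simp
  have finH: "finite (hyperplane d n i)"
    by (simp add: hyperplane_def finite_multi_indices)
  have "{\<beta> \<in> hyperplane d n i. card (blocking_rows d p \<beta> - {i}) \<noteq> d - 1} \<subseteq> (\<Union>kl\<in>P. G kl)"
  proof (rule subsetI, rule ccontr)
    fix \<beta> assume b: "\<beta> \<in> {\<beta> \<in> hyperplane d n i. card (blocking_rows d p \<beta> - {i}) \<noteq> d - 1}"
      and not: "\<beta> \<notin> (\<Union>kl\<in>P. G kl)"
    have b1: "\<beta> 1 = i" and bk: "\<beta> k \<in> {1..n}" if "k \<in> {1..d}" for k
      using b that by (auto simp: hyperplane_def multi_indices_def PiE_iff)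
    note b1 = b1[of 1]
    have sep: "element_at p k (\<beta> k) 1 \<noteq> element_at p l (\<beta> l) 1" if "(k, l) \<in> P" for k l
    proof
      assume eq: "element_at p k (\<beta> k) 1 = element_at p l (\<beta> l) 1"
      have kl: "k \<in> {1..d}" "l \<in> {1..d}" using that by (auto simp: P_def)
      \<comment> \<open>Two elements of \<open>p\<close> in the same row coincide; the
        \<open>l\<close>-th coordinate of the common element is \<open>\<beta> l\<close>.\<close>
      have "element_at p k (\<beta> k) = element_at p l (\<beta> l)"
        using eq element_at(1,3)[OF p] kl bk d by (metis atLeastAtMost_iff le_refl le_trans)
      then have "\<beta> l = element_at p k (\<beta> k) l"
        using element_at(2)[OF p kl(2) bk[OF kl(2)]] by simp
      with not that b show False by (auto simp: G_def)
    qed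
    have "inj_on (\<lambda>k. element_at p k (\<beta> k) 1) {2..d}"
    proof (intro inj_onI, rule ccontr)
      fix k l assume "k \<in> {2..d}" "l \<in> {2..d}" "k \<noteq> l"
        and eq: "element_at p k (\<beta> k) 1 = element_at p l (\<beta> l) 1"
      then have "(k, l) \<in> P" by (auto simp: P_def)
      then show False using sep eq by blast
    qed
    moreover have "i \<notin> blocking_rows d p \<beta>"
    proof
      assume "i \<in> blocking_rows d p \<beta>"
      then obtain l where l: "l \<in> {2..d}" "element_at p l (\<beta> l) 1 = i"
        by (auto simp: blocking_rows_def)
      moreover have "element_at p 1 (\<beta> 1) 1 = i"
        using element_at(2)[OF p, of 1] d b1 i by simp
      moreover have "(1, l) \<in> P" using l d by (auto simp: P_def)
      ultimately show False using sep by metis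
    qed
    ultimately have "card (blocking_rows d p \<beta> - {i}) = d - 1"
      by (simp add: blocking_rows_def card_image)
    with b show False by simp
  qed
  then have "card {\<beta> \<in> hyperplane d n i. card (blocking_rows d p \<beta> - {i}) \<noteq> d - 1} \<le> card (\<Union>kl\<in>P. G kl)"
    using finP finH by (intro card_mono) (auto simp: G_def)
  also have "\<dots> \<le> (\<Sum>kl\<in>P. card (G kl))"
    by (rule card_UN_le[OF finP])
  also have "\<dots> \<le> (\<Sum>kl\<in>P. n ^ (d - 2))"
  proof (rule sum_mono)
    fix kl assume "kl \<in> P"
    then show "card (G kl) \<le> n ^ (d - 2)"
      using card_hyperplane_graph_le[of "fst kl" d "snd kl" n i "\<lambda>v. element_at p (fst kl) v (snd kl)"]
      by (auto simp: P_def G_def split: prod.splits)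
  qed
  also have "\<dots> \<le> d\<^sup>2 * n ^ (d - 2)"
    using card_mono[OF _ P] by (simp add: power2_eq_square)
  finally show ?thesis .
qed

lemma blocking_rows_subset:
  assumes p: "p \<in> diagonals d n" and "\<beta> \<in> multi_indices d n" "d \<ge> 2"
  shows "blocking_rows d p \<beta> \<subseteq> {1..n}"
proof
  fix j assume "j \<in> blocking_rows d p \<beta>"
  then obtain k where k: "k \<in> {2..d}" "j = element_at p k (\<beta> k) 1"
    by (auto simp: blocking_rows_def)
  then have "k \<in> {1..d}" "\<beta> k \<in> {1..n}"
    using assms(2) by (auto simp: multi_indices_def PiE_iff)
  then have "element_at p k (\<beta> k) \<in> multi_indices d n"
    using element_at(1)[OF p] p by (auto simp: diagonals_def)
  then show "j \<in> {1..n}"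
    using k assms(3) by (auto simp: multi_indices_def PiE_iff)
qed

text \<open>Double counting over positions and times. A position with \<open>d - 1\<close> blocking
  rows besides \<open>i\<close> survives with probability \<open>(u/m)^(d-1)\<close>; every other
  position is counted with probability at most 1, and \<open>card_degenerate_le\<close> bounds their
  number.\<close>

lemma sum_card_available_le:
  assumes p: "p \<in> diagonals d n" and i: "i \<in> {1..n}" and d: "d \<ge> 2" and u: "u \<in> {1..m}"
    and Z: "Z \<subseteq> hyperplane d n i" "real (card Z) \<le> R"
  shows "(\<Sum>t | t \<in> {1..n} \<rightarrow>\<^sub>E {1..m} \<and> t i = u.
      real (card {\<beta> \<in> Z. \<forall>j\<in>blocking_rows d p \<beta>. t j \<le> t i}))
    \<le> real m ^ (n - 1) * (R * (real u / real m) ^ (d - 1) + real d ^ 2 * real n ^ (d - 2))"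
proof -
  let ?S = "{t \<in> {1..n} \<rightarrow>\<^sub>E {1..m}. t i = u}" and ?s = "real u / real m"
  let ?bad = "\<lambda>\<beta>. card (blocking_rows d p \<beta> - {i}) \<noteq> d - 1"
  have finZ: "finite Z"
    by (rule finite_subset[OF Z(1)]) (simp add: hyperplane_def finite_multi_indices)
  have finS: "finite ?S"
    by (intro finite_Collect_conjI disjI1) (simp add: finite_PiE)
  have s: "0 \<le> ?s" "?s \<le> 1" using u by auto
  have "(\<Sum>t\<in>?S. real (card {\<beta> \<in> Z. \<forall>j\<in>blocking_rows d p \<beta>. t j \<le> t i}))
      = (\<Sum>t\<in>?S. \<Sum>\<beta>\<in>Z. of_bool (\<forall>j\<in>blocking_rows d p \<beta>. t j \<le> t i))"
    using finZ by (simp add: Int_def)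
  also have "\<dots> = (\<Sum>\<beta>\<in>Z. \<Sum>t\<in>?S. of_bool (\<forall>j\<in>blocking_rows d p \<beta>. t j \<le> t i))"
    by (rule sum.swap)
  also have "\<dots> \<le> (\<Sum>\<beta>\<in>Z. real m ^ (n - 1) * (?s ^ (d - 1) + of_bool (?bad \<beta>)))"
  proof (rule sum_mono)
    fix \<beta> assume "\<beta> \<in> Z"
    then have "blocking_rows d p \<beta> \<subseteq> {1..n}"
      using Z(1) by (intro blocking_rows_subset[OF p _ d]) (auto simp: hyperplane_def)
    then have K: "blocking_rows d p \<beta> - {i} \<subseteq> {1..n} - {i}" by blast
    have "(\<Sum>t\<in>?S. of_bool (\<forall>j\<in>blocking_rows d p \<beta>. t j \<le> t i))
        = real (card (?S \<inter> {t. \<forall>j\<in>blocking_rows d p \<beta>. t j \<le> t i}))"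
      using finS by (simp only: sum_of_bool_eq)
    \<comment> \<open>Row \<open>i\<close> may itself occur among the blocking rows, but its
      condition \<open>t i \<le> t i\<close> is trivial.\<close>
    also have "?S \<inter> {t. \<forall>j\<in>blocking_rows d p \<beta>. t j \<le> t i}
        = {t \<in> {1..n} \<rightarrow>\<^sub>E {1..m}. t i = u \<and> (\<forall>j\<in>blocking_rows d p \<beta> - {i}. t j \<le> u)}"
      by auto
    also have "real (card \<dots>) = real m ^ (n - 1) * ?s ^ card (blocking_rows d p \<beta> - {i})"
      using card_bounded_functions[OF _ i K u] by simp
    also have "\<dots> \<le> real m ^ (n - 1) * (?s ^ (d - 1) + of_bool (?bad \<beta>))"
      using s by (intro mult_left_mono) (auto simp: power_le_one add_increasing)
    finally show "(\<Sum>t\<in>?S. of_bool (\<forall>j\<in>blocking_rows d p \<beta>. t j \<le> t i))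
        \<le> real m ^ (n - 1) * (?s ^ (d - 1) + of_bool (?bad \<beta>))" .
  qed
  also have "\<dots> = real m ^ (n - 1) * (real (card Z) * ?s ^ (d - 1) + real (card {\<beta> \<in> Z. ?bad \<beta>}))"
    using finZ by (simp add: sum.distrib Int_def flip: sum_distrib_left)
  also have "\<dots> \<le> real m ^ (n - 1) * (R * ?s ^ (d - 1) + real d ^ 2 * real n ^ (d - 2))"
  proof (intro mult_left_mono add_mono mult_right_mono Z(2))
    have "card {\<beta> \<in> Z. ?bad \<beta>} \<le> card {\<beta> \<in> hyperplane d n i. ?bad \<beta>}"
      using Z(1) by (intro card_mono) (auto simp: hyperplane_def finite_multi_indices)
    also have "\<dots> \<le> d\<^sup>2 * n ^ (d - 2)"
      by (rule card_degenerate_le[OF p i d])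
    finally have "real (card {\<beta> \<in> Z. ?bad \<beta>}) \<le> real (d\<^sup>2 * n ^ (d - 2))"
      by (rule of_nat_mono)
    then show "real (card {\<beta> \<in> Z. ?bad \<beta>}) \<le> real d ^ 2 * real n ^ (d - 2)"
      by simp
  qed (use s in auto)
  finally show ?thesis .
qed

section \<open>Jensen inequalities for \<open>ln\<close> and \<open>exp\<close>\<close>

text \<open>Tangent line bound \<open>ln z \<le> z - 1\<close> at \<open>z = f t / y\<close>, where
  \<open>y\<close> may be any upper bound of the mean.\<close>

lemma sum_ln_le_of_sum_le:
  fixes f :: "'a \<Rightarrow> real"
  assumes "finite S" "\<And>t. t \<in> S \<Longrightarrow> 0 < f t" "0 < y" "(\<Sum>t\<in>S. f t) \<le> real (card S) * y"
  shows "(\<Sum>t\<in>S. ln (f t)) \<le> real (card S) * ln y"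
proof -
  have "(\<Sum>t\<in>S. ln (f t)) \<le> (\<Sum>t\<in>S. ln y + (f t / y - 1))"
  proof (rule sum_mono)
    fix t assume "t \<in> S"
    then have "ln (f t / y) \<le> f t / y - 1" "ln (f t / y) = ln (f t) - ln y"
      using assms(2,3) by (intro ln_le_minus_one, auto simp: ln_div less_imp_neq[symmetric])
    then show "ln (f t) \<le> ln y + (f t / y - 1)" by simp
  qed
  also have "\<dots> = real (card S) * ln y + ((\<Sum>t\<in>S. f t) / y - real (card S))"
    by (simp add: sum.distrib sum_subtractf sum_divide_distrib)
  also have "\<dots> \<le> real (card S) * ln y"
    using assms(3,4) by (simp add: divide_le_eq)
  finally show ?thesis .
qed

text \<open>The graph of \<open>exp\<close> lies above its tangent at \<open>y\<close>.\<close>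

lemma sum_exp_ge_of_sum_ge:
  fixes f :: "'a \<Rightarrow> real"
  assumes "(\<Sum>t\<in>S. f t) \<ge> real (card S) * y"
  shows "(\<Sum>t\<in>S. exp (f t)) \<ge> real (card S) * exp y"
proof -
  have "real (card S) * exp y \<le> exp y * (real (card S) * (1 - y) + (\<Sum>t\<in>S. f t))"
    using assms by (simp add: algebra_simps)
  also have "\<dots> = (\<Sum>t\<in>S. exp y * (1 + (f t - y)))"
    by (simp add: sum.distrib sum_subtractf algebra_simps flip: sum_distrib_left)
  also have "\<dots> \<le> (\<Sum>t\<in>S. exp (f t))"
  proof (rule sum_mono)
    fix t
    have "exp y * (1 + (f t - y)) \<le> exp y * exp (f t - y)"
      by (intro mult_left_mono exp_ge_add_one_self) auto
    then show "exp y * (1 + (f t - y)) \<le> exp (f t)"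
      by (simp flip: exp_add)
  qed
  finally show ?thesis .
qed

section \<open>The entropy bound with finitely many times\<close>

lemma sum_prod_inverse_available_le_1:
  fixes d n :: nat and A :: multi_matrix and t :: "nat \<Rightarrow> nat"
  assumes d: "d \<ge> 2"
  defines "D \<equiv> {p \<in> diagonals d n. \<forall>\<alpha>\<in>p. A \<alpha> = 1}"
  shows "(\<Sum>p\<in>D. \<Prod>i\<in>{1..n}. 1 / real (card {\<beta> \<in> hyperplane d n i. A \<beta> = 1 \<and>
    (\<forall>j\<in>blocking_rows d p \<beta>. t j \<le> t i)})) \<le> 1"
proof (rule sum_prod_inverse_choices_le_1[where t = t and ev = "\<lambda>p. element_at p 1"])
  have one: "1 \<in> {1..d}" using d by simp
  show "finite {1..n}" by simp
  show "finite D"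
    by (rule finite_subset[of _ "Pow (multi_indices d n)"])
       (auto simp: D_def diagonals_def finite_multi_indices)
  show "p = q" if "p \<in> D" "q \<in> D" and eq: "\<And>i. i \<in> {1..n} \<Longrightarrow> element_at p 1 i = element_at q 1 i" for p q
  proof -
    have p: "p \<in> diagonals d n" and q: "q \<in> diagonals d n" using that by (auto simp: D_def)
    have img: "element_at s 1 ` {1..n} = s" if s: "s \<in> diagonals d n" for s
    proof -
      have "element_at s 1 ` {1..n} \<subseteq> s" using element_at(1)[OF s one] by blast
      moreover have "\<alpha> \<in> element_at s 1 ` {1..n}" if "\<alpha> \<in> s" for \<alpha>
        using element_at(3)[OF s one that] bij_betw_apply[OF diagonal_bij[OF s one] that]
        by (metis image_eqI)
      ultimately show ?thesis by blast
    qed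
    show "p = q" using img[OF p] img[OF q] eq by (metis image_cong)
  qed
  fix p i assume "p \<in> D" and i: "i \<in> {1..n}"
  then have p: "p \<in> diagonals d n" by (simp add: D_def)
  \<comment> \<open>If a blocking row \<open>j\<close> had larger time, \<open>q\<close> would
    contain the element of \<open>p\<close> in row \<open>j\<close>. That element shares a
    coordinate with \<open>\<beta> \<in> q\<close>, hence equals \<open>\<beta>\<close>, which
    forces \<open>j = i\<close>.\<close>
  have "(\<lambda>q. element_at q 1 i) ` {q \<in> D. \<forall>j\<in>{1..n}. t i < t j \<longrightarrow> element_at q 1 j = element_at p 1 j}
    \<subseteq> {\<beta> \<in> hyperplane d n i. A \<beta> = 1 \<and> (\<forall>j\<in>blocking_rows d p \<beta>. t j \<le> t i)}" (is "?L \<subseteq> ?R")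
  proof
    fix \<beta> assume "\<beta> \<in> ?L"
    then obtain q where qD: "q \<in> D" and \<beta>: "\<beta> = element_at q 1 i"
      and agree: "\<And>j. j \<in> {1..n} \<Longrightarrow> t i < t j \<Longrightarrow> element_at q 1 j = element_at p 1 j"
      by blast
    have q: "q \<in> diagonals d n" and A: "\<forall>\<alpha>\<in>q. A \<alpha> = 1" using qD by (auto simp: D_def)
    have \<beta>q: "\<beta> \<in> q" "\<beta> 1 = i" using element_at[OF q one] i by (auto simp: \<beta>)
    then have \<beta>m: "\<beta> \<in> multi_indices d n" using q by (auto simp: diagonals_def)
    have "t j \<le> t i" if j: "j \<in> blocking_rows d p \<beta>" for j
    proof (rule ccontr)
      assume less: "\<not> t j \<le> t i"
      obtain k where "k \<in> {2..d}" and jk: "j = element_at p k (\<beta> k) 1"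
        using j by (auto simp: blocking_rows_def)
      then have k: "k \<in> {1..d}" by simp
      define \<alpha> where "\<alpha> = element_at p k (\<beta> k)"
      have "\<beta> k \<in> {1..n}" using \<beta>m k by (auto simp: multi_indices_def PiE_iff)
      then have \<alpha>: "\<alpha> \<in> p" "\<alpha> k = \<beta> k" using element_at[OF p k] by (auto simp: \<alpha>_def)
      have jn: "j \<in> {1..n}" using blocking_rows_subset[OF p \<beta>m d] j by blast
      have "element_at q 1 j = \<alpha>"
        using agree[OF jn] less element_at(3)[OF p one \<alpha>(1)] jk by (simp add: \<alpha>_def)
      then have "\<alpha> \<in> q" using element_at(1)[OF q one jn] by simp
      then have "\<alpha> = \<beta>"
        using \<alpha>(2) \<beta>q(1) element_at(3)[OF q k] by metis
      then have "j = i" using jk \<beta>q by (simp add: \<alpha>_def)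
      then show False using less by simp
    qed
    then show "\<beta> \<in> ?R" using \<beta>q \<beta>m A by (auto simp: hyperplane_def)
  qed
  then show "real (card ?L) \<le> real (card ?R)"
    by (intro of_nat_mono card_mono) (auto simp: hyperplane_def finite_multi_indices)
qed

text \<open>Sum the subprobability bound over all time functions. For each diagonal, Jensen for
  \<open>ln\<close> bounds the mean of the logarithms of the counts, and Jensen for
  \<open>exp\<close> turns this into mean weight at least \<open>exp (- B)\<close>; hence at most
  \<open>exp B\<close> diagonals consist of ones.\<close>

theorem per_le_exp:
  assumes A: "A \<in> Lambda d n r" and d: "d \<ge> 2" and n: "n \<ge> 1" and m: "m \<ge> 1"
  shows "per d n A \<le> exp (\<Sum>i=1..n. (\<Sum>u=1..m.
    ln (real_of_int (r i) * (real u / real m) ^ (d - 1) + real d ^ 2 * real n ^ (d - 2))) / real m)"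
proof -
  define D where "D = {p \<in> diagonals d n. \<forall>\<alpha>\<in>p. A \<alpha> = 1}"
  define T where "T = {1..n} \<rightarrow>\<^sub>E {1..m}"
  define N where "N = (\<lambda>p (t :: nat \<Rightarrow> nat) i. real (card {\<beta> \<in> hyperplane d n i. A \<beta> = 1 \<and>
    (\<forall>j\<in>blocking_rows d p \<beta>. t j \<le> t i)}))"
  define Y where "Y = (\<lambda>i u. real_of_int (r i) * (real u / real m) ^ (d - 1) + real d ^ 2 * real n ^ (d - 2))"
  define B where "B = (\<Sum>i=1..n. (\<Sum>u=1..m. ln (Y i u)) / real m)"
  have one: "1 \<in> {1..d}" using d by simp
  have finT: "finite T" by (simp add: T_def finite_PiE)
  have cardT: "real (card T) = real m ^ n" by (simp add: T_def card_PiE)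
  have ones_le: "real (card {\<beta> \<in> hyperplane d n i. A \<beta> = 1}) \<le> real_of_int (r i)" if "i \<in> {1..n}" for i
  proof -
    have "int (card {\<beta> \<in> hyperplane d n i. A \<beta> = 1}) \<le> r i"
      using A that by (simp add: Lambda_def)
    then show ?thesis by linarith
  qed
  have Ypos: "0 < Y i u" if "i \<in> {1..n}" for i u
  proof -
    have "0 \<le> real_of_int (r i)" using ones_le[OF that] by linarith
    then show ?thesis
      unfolding Y_def using d n by (intro add_nonneg_pos mult_nonneg_nonneg mult_pos_pos) auto
  qed
  have Npos: "0 < N p t i" if "p \<in> D" "i \<in> {1..n}" for p t i
  proof -
    have p: "p \<in> diagonals d n" using that by (simp add: D_def)
    define \<alpha> where "\<alpha> = element_at p 1 i"
    have \<alpha>: "\<alpha> \<in> p" "\<alpha> 1 = i" using element_at[OF p one] that by (auto simp: \<alpha>_def)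
    \<comment> \<open>The element of \<open>p\<close> in row \<open>i\<close> is always available to
      \<open>p\<close> itself, so every count is positive.\<close>
    have "blocking_rows d p \<alpha> \<subseteq> {i}"
      using element_at(3)[OF p _ \<alpha>(1)] \<alpha>(2) by (auto simp: blocking_rows_def)
    then have "\<alpha> \<in> {\<beta> \<in> hyperplane d n i. A \<beta> = 1 \<and> (\<forall>j\<in>blocking_rows d p \<beta>. t j \<le> t i)}"
      using \<alpha> that by (fastforce simp: D_def diagonals_def hyperplane_def)
    then show ?thesis
      unfolding N_def of_nat_0_less_iff card_gt_0_iff by (auto simp: hyperplane_def finite_multi_indices)
  qed
  have mean_ln: "(\<Sum>t\<in>T. \<Sum>i=1..n. ln (N p t i)) \<le> real (card T) * B" if "p \<in> D" for p
  proof -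
    have p: "p \<in> diagonals d n" using that by (simp add: D_def)
    have row: "(\<Sum>t\<in>T. ln (N p t i)) \<le> real (card T) * ((\<Sum>u=1..m. ln (Y i u)) / real m)"
      if i: "i \<in> {1..n}" for i
    proof -
      \<comment> \<open>Conditioning on the time \<open>u\<close> of row \<open>i\<close>; each
        class has \<open>m ^ (n - 1)\<close> members.\<close>
      have "(\<Sum>t\<in>T. ln (N p t i)) = (\<Sum>u=1..m. \<Sum>t | t \<in> T \<and> t i = u. ln (N p t i))"
        using i by (intro sum.group[symmetric] finT) (auto simp: T_def PiE_iff)
      also have "\<dots> \<le> (\<Sum>u=1..m. real m ^ (n - 1) * ln (Y i u))"
      proof (rule sum_mono)
        fix u assume u: "u \<in> {1..m}"
        have card: "real (card {t \<in> T. t i = u}) = real m ^ (n - 1)"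
          using card_bounded_functions[OF _ i _ u, of "{}"] by (simp add: T_def)
        have "(\<Sum>t | t \<in> T \<and> t i = u. N p t i) \<le> real m ^ (n - 1) * Y i u"
          using sum_card_available_le[OF p i d u _ ones_le[OF i]]
          unfolding N_def Y_def T_def by simp
        then show "(\<Sum>t | t \<in> T \<and> t i = u. ln (N p t i)) \<le> real m ^ (n - 1) * ln (Y i u)"
          unfolding card[symmetric]
          using finT Npos[OF \<open>p \<in> D\<close> i] Ypos[OF i] by (intro sum_ln_le_of_sum_le) auto
      qed
      also have "\<dots> = real (card T) * ((\<Sum>u=1..m. ln (Y i u)) / real m)"
        unfolding cardT sum_distrib_left[symmetric]
        using m n by (cases n) (auto simp: field_simps)
      finally show ?thesis .
    qed
    have "(\<Sum>t\<in>T. \<Sum>i=1..n. ln (N p t i)) = (\<Sum>i=1..n. \<Sum>t\<in>T. ln (N p t i))"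
      by (rule sum.swap)
    also have "\<dots> \<le> (\<Sum>i=1..n. real (card T) * ((\<Sum>u=1..m. ln (Y i u)) / real m))"
      by (intro sum_mono row)
    finally show ?thesis by (simp add: B_def sum_distrib_left)
  qed
  have weight: "real (card T) * exp (- B) \<le> (\<Sum>t\<in>T. \<Prod>i\<in>{1..n}. 1 / N p t i)" if "p \<in> D" for p
  proof -
    have "real (card T) * exp (- B) \<le> (\<Sum>t\<in>T. exp (- (\<Sum>i=1..n. ln (N p t i))))"
      using mean_ln[OF that] by (intro sum_exp_ge_of_sum_ge) (simp add: sum_negf)
    also have "\<dots> = (\<Sum>t\<in>T. \<Prod>i\<in>{1..n}. 1 / N p t i)"
      using Npos[OF that] by (simp add: exp_minus exp_sum divide_inverse flip: prod_inversef)
    finally show ?thesis .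
  qed
  have "real (card D) * (real (card T) * exp (- B)) \<le> (\<Sum>p\<in>D. \<Sum>t\<in>T. \<Prod>i\<in>{1..n}. 1 / N p t i)"
    using sum_mono[OF weight] by simp
  also have "\<dots> = (\<Sum>t\<in>T. \<Sum>p\<in>D. \<Prod>i\<in>{1..n}. 1 / N p t i)"
    by (rule sum.swap)
  also have "\<dots> \<le> (\<Sum>t\<in>T. 1)"
    unfolding N_def D_def by (intro sum_mono sum_prod_inverse_available_le_1 d)
  finally have "real (card T) * (real (card D) * exp (- B)) \<le> real (card T) * 1"
    by (simp add: mult_ac)
  moreover have "0 < real (card T)" using m by (simp add: cardT)
  ultimately have "real (card D) * exp (- B) \<le> 1"
    by (simp only: mult_le_cancel_left_pos)
  then have "real (card D) \<le> exp B"
    by (simp add: exp_minus field_simps)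
  moreover have "per d n A = real (card D)"
    unfolding D_def using A by (intro per_zero_one) (simp add: Lambda_def)
  ultimately show ?thesis by (simp add: B_def Y_def)
qed

section \<open>Stirling estimates and limits\<close>

lemma ln_fact_bounds:
  assumes "n \<ge> 1"
  shows "real n * ln (real n) - real n \<le> ln (fact n)"
    and "ln (fact n) \<le> (real n + 1) * ln (real n) - real n + 1"
proof -
  \<comment> \<open>The increments needed by the induction: both follow from
    \<open>ln z \<le> z - 1\<close>, at \<open>z = (k + 1) / k\<close> and at
    \<open>z = k / (k + 1)\<close>.\<close>
  have ln_step: "real k * (ln (real (Suc k)) - ln (real k)) \<le> 1"
    "1 \<le> (real k + 1) * (ln (real (Suc k)) - ln (real k))" if "k \<ge> 1" for k
  proof -
    have "ln (real (Suc k) / real k) \<le> real (Suc k) / real k - 1"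
      using that by (intro ln_le_minus_one) auto
    then show "real k * (ln (real (Suc k)) - ln (real k)) \<le> 1"
      using that by (simp add: ln_div field_simps)
    have "ln (real k / real (Suc k)) \<le> real k / real (Suc k) - 1"
      using that by (intro ln_le_minus_one) auto
    then show "1 \<le> (real k + 1) * (ln (real (Suc k)) - ln (real k))"
      using that by (simp add: ln_div field_simps)
  qed
  have "real n * ln (real n) - real n \<le> ln (fact n) \<and>
    ln (fact n) \<le> (real n + 1) * ln (real n) - real n + 1"
    using assms
  proof (induction n rule: dec_induct)
    case (step k)
    have "ln (fact (Suc k)) = ln (real (Suc k)) + ln (fact k)"
      by (simp add: ln_mult del: of_nat_Suc)
    then show ?case
      using step ln_step[of k] by (simp add: algebra_simps)
  qed simp
  then show "real n * ln (real n) - real n \<le> ln (fact n)"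
    "ln (fact n) \<le> (real n + 1) * ln (real n) - real n + 1" by blast+
qed

text \<open>With \<open>N\<close> the ceiling of \<open>x\<close>, Stirling gives
  \<open>ln N - 1 \<le> ln (fact N) / N\<close>, and \<open>x \<le> N\<close>.\<close>

lemma F_root_lower:
  assumes "x > 0"
  shows "0 < F_root x" and "ln x - 1 \<le> ln (F_root x)"
proof -
  show "0 < F_root x" by (simp add: F_root_def)
  define N where "N = nat \<lceil>x\<rceil>"
  have "\<lceil>x\<rceil> \<ge> 1" using assms by linarith
  then have N: "N \<ge> 1" "of_int \<lceil>x\<rceil> = real N" unfolding N_def by linarith+
  have "x \<le> real N" using N(2) le_of_int_ceiling[of x] by simp
  then have "ln x - 1 \<le> ln (real N) - 1" using assms by simp
  also have "\<dots> \<le> ln (fact N) / real N"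
    using ln_fact_bounds(1)[OF N(1)] N(1) by (simp add: field_simps)
  also have "\<dots> = ln (F_root x)"
    using N by (simp add: F_root_def ln_powr flip: N_def)
  finally show "ln x - 1 \<le> ln (F_root x)" .
qed

text \<open>The mean is a Riemann sum for the integral of \<open>e * ln s\<close> over
  \<open>[0,1]\<close>, which is \<open>- e\<close>. Writing it through \<open>ln (fact m)\<close>
  makes the error explicit.\<close>

lemma mean_ln_power_le:
  assumes "\<delta> > 0"
  obtains m :: nat where "m \<ge> 1" "(\<Sum>u=1..m. ln ((real u / real m) ^ e)) / real m < \<delta> - real e"
proof -
  have "(\<lambda>m. ln (real m) / real m) \<longlonglongrightarrow> 0"
    by (rule filterlim_compose[OF ln_x_over_x_tendsto_0 filterlim_real_sequentially])
  then have "(\<lambda>m. real e * (ln (real m) / real m + 1 / real m)) \<longlonglongrightarrow> real e * (0 + 0)"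
    by (intro tendsto_intros lim_1_over_n)
  then have "\<forall>\<^sub>F m in sequentially. real e * (ln (real m) / real m + 1 / real m) < \<delta>"
    using assms by (intro order_tendstoD) auto
  then have "\<forall>\<^sub>F m in sequentially. real e * (ln (real m) / real m + 1 / real m) < \<delta> \<and> m \<ge> 1"
    using eventually_ge_at_top by (rule eventually_conj)
  then obtain m :: nat where m: "m \<ge> 1" and small: "real e * (ln (real m) / real m + 1 / real m) < \<delta>"
    by (auto simp: eventually_sequentially)
  have ln_fact: "ln (fact m :: real) = (\<Sum>u=1..m. ln (real u))"
    by (induction m) (simp_all add: ln_mult)
  have "(\<Sum>u=1..m. ln ((real u / real m) ^ e)) = (\<Sum>u=1..m. real e * (ln (real u) - ln (real m)))"
    using m by (intro sum.cong) (auto simp: ln_realpow ln_div)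
  also have "\<dots> = real e * (ln (fact m) - real m * ln (real m))"
    by (simp add: sum_subtractf ln_fact flip: sum_distrib_left)
  also have "\<dots> \<le> real e * (ln (real m) - real m + 1)"
    using ln_fact_bounds(2)[OF m] by (intro mult_left_mono) (auto simp: algebra_simps)
  finally have "(\<Sum>u=1..m. ln ((real u / real m) ^ e)) / real m
    \<le> real e * (ln (real m) - real m + 1) / real m"
    by (intro divide_right_mono) auto
  also have "\<dots> = real e * (ln (real m) / real m + 1 / real m) - real e"
    using m by (simp add: field_simps)
  also have "\<dots> < \<delta> - real e" using small by simp
  finally show ?thesis using that m by blast
qed

text \<open>First fix \<open>m\<close>, then let \<open>x\<close> tend to infinity: as
  \<open>u \<ge> 1\<close>, each logarithm is continuous at its limit.\<close>

lemma eventually_mean_ln_le: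
  fixes C :: real
  assumes "\<delta> > 0"
  obtains m :: nat where "m \<ge> 1"
    "\<forall>\<^sub>F x in at_top. (\<Sum>u=1..m. ln ((real u / real m) ^ e + C / x)) / real m \<le> \<delta> - real e"
proof -
  obtain m :: nat where m: "m \<ge> 1" "(\<Sum>u=1..m. ln ((real u / real m) ^ e)) / real m < \<delta> - real e"
    using mean_ln_power_le[OF assms] .
  have "((\<lambda>x. (\<Sum>u=1..m. ln ((real u / real m) ^ e + C / x)) / real m)
      \<longlongrightarrow> (\<Sum>u=1..m. ln ((real u / real m) ^ e + 0)) / real m) at_top"
    using m(1) by (intro tendsto_intros tendsto_divide_0[OF tendsto_const] filterlim_at_top_imp_at_infinity
        filterlim_ident) auto
  then have "\<forall>\<^sub>F x in at_top. (\<Sum>u=1..m. ln ((real u / real m) ^ e + C / x)) / real m < \<delta> - real e"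
    using m(2) by (intro order_tendstoD) auto
  then show ?thesis
    by (intro that[OF m(1)]) (auto elim: eventually_mono)
qed

lemma exists_vanishing_exponent:
  fixes L G :: "nat \<Rightarrow> real"
  assumes G: "\<forall>\<^sub>F n in sequentially. G n > 0"
    and L: "\<And>\<delta>. \<delta> > 0 \<Longrightarrow> \<forall>\<^sub>F n in sequentially. L n \<le> G n * exp (\<delta> * real n)"
  shows "\<exists>\<epsilon>. \<epsilon> \<longlonglongrightarrow> 0 \<and> (\<forall>\<^sub>F n in sequentially. L n \<le> G n * exp (\<epsilon> n * real n))"
proof (intro exI conjI)
  \<comment> \<open>The least nonnegative exponent that works. The default 0 keeps \<open>ln\<close>
    away from nonpositive values of \<open>L n\<close>.\<close>
  define \<epsilon> where "\<epsilon> = (\<lambda>n. if L n \<le> G n then 0 else ln (L n / G n) / real n)"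
  have pos: "\<forall>\<^sub>F n in sequentially. G n > 0 \<and> n \<ge> 1"
    by (intro eventually_conj G eventually_ge_at_top)
  show "\<epsilon> \<longlonglongrightarrow> 0"
  proof (rule tendstoI)
    fix \<delta> :: real assume "\<delta> > 0"
    \<comment> \<open>Half of \<open>\<delta>\<close> yields a strict bound in the end.\<close>
    then have "\<forall>\<^sub>F n in sequentially. L n \<le> G n * exp (\<delta> / 2 * real n)"
      by (intro L) simp
    then show "\<forall>\<^sub>F n in sequentially. dist (\<epsilon> n) 0 < \<delta>"
      using pos
    proof eventually_elim
      case (elim n)
      show ?case
      proof (cases "L n \<le> G n")
        case False
        then have q: "L n / G n > 1" using elim by (simp add: less_divide_eq)
        have "L n / G n \<le> exp (\<delta> / 2 * real n)"
          using elim by (simp add: divide_le_eq mult.commute)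
        then have "ln (L n / G n) \<le> \<delta> / 2 * real n"
          using q by (metis ln_exp ln_mono less_trans zero_less_one)
        then have "ln (L n / G n) / real n \<le> \<delta> / 2"
          using elim by (simp add: divide_le_eq)
        moreover have "0 \<le> ln (L n / G n) / real n"
          using q by (intro divide_nonneg_nonneg ln_ge_zero) auto
        ultimately have "\<bar>ln (L n / G n) / real n\<bar> < \<delta>"
          using \<open>\<delta> > 0\<close> by linarith
        then show ?thesis using False by (simp add: \<epsilon>_def)
      qed (use \<open>\<delta> > 0\<close> in \<open>simp add: \<epsilon>_def\<close>)
    qed
  qed
  show "\<forall>\<^sub>F n in sequentially. L n \<le> G n * exp (\<epsilon> n * real n)"
    using pos
  proof eventually_elim
    case (elim n)
    show ?case
    proof (cases "L n \<le> G n")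
      case False
      then have "L n / G n > 0" using elim by (intro divide_pos_pos) auto
      then show ?thesis using elim False by (simp add: \<epsilon>_def)
    qed (simp add: \<epsilon>_def)
  qed
qed

section \<open>Assembling the asymptotic bound\<close>

text \<open>Factoring \<open>n ^ (d - 2) * x i\<close> out of each argument of \<open>ln\<close> in
  \<open>per_le_exp\<close> leaves the mean controlled by \<open>mean\<close>.\<close>

lemma per_le:
  assumes A: "A \<in> Lambda d n r" and d: "d \<ge> 2" and n: "n \<ge> 1" and m: "m \<ge> 1"
    and x: "\<And>i. i \<in> {1..n} \<Longrightarrow> x i = real_of_int (r i) / real n ^ (d - 2)"
    and pos: "\<And>i. i \<in> {1..n} \<Longrightarrow> x i > 0"
    and mean: "\<And>i. i \<in> {1..n} \<Longrightarrow>
      (\<Sum>u=1..m. ln ((real u / real m) ^ (d - 1) + real d ^ 2 / x i)) / real m \<le> \<delta> - real (d - 1)"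
  shows "per d n A \<le> fact n ^ (d - 2) * (\<Prod>i=1..n. F_root (x i)) * exp (\<delta> * real n)"
proof -
  let ?c = "real n ^ (d - 2)"
  define Y where "Y = (\<lambda>i u. real_of_int (r i) * (real u / real m) ^ (d - 1) + real d ^ 2 * ?c)"
  have c: "?c > 0" using n by simp
  have row: "(\<Sum>u=1..m. ln (Y i u)) / real m
      \<le> real (d - 2) * (ln (fact n) / real n) + ln (F_root (x i)) + \<delta>" if i: "i \<in> {1..n}" for i
  proof -
    define z where "z = (\<lambda>u. (real u / real m) ^ (d - 1) + real d ^ 2 / x i)"
    have "ln (Y i u) = ln ?c + ln (x i) + ln (z u)" for u
    proof -
      have z: "z u > 0" using pos[OF i] d by (auto simp: z_def intro!: add_nonneg_pos)
      have "real_of_int (r i) = x i * ?c"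
        using x[OF i] n by simp
      then have "Y i u = ?c * x i * z u"
        using pos[OF i] by (simp add: Y_def z_def distrib_left)
      then show ?thesis using z n pos[OF i] by (simp add: ln_mult)
    qed
    then have "(\<Sum>u=1..m. ln (Y i u)) / real m = ln ?c + ln (x i) + (\<Sum>u=1..m. ln (z u)) / real m"
      using m by (simp add: sum.distrib add_divide_distrib)
    also have "\<dots> \<le> ln ?c + ln (x i) + (\<delta> - real (d - 1))"
      using mean[OF i] by (simp add: z_def)
    \<comment> \<open>The loss \<open>d - 1\<close> is split: \<open>d - 2\<close> units go with the
      factors \<open>n\<close> to form roots of \<open>fact n\<close>, and one unit goes with
      \<open>x i\<close> to form \<open>F_root\<close>.\<close>
    also have "\<dots> = real (d - 2) * (ln (real n) - 1) + (ln (x i) - 1) + \<delta>"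
      using d n by (simp add: ln_realpow of_nat_diff algebra_simps)
    also have "\<dots> \<le> real (d - 2) * (ln (fact n) / real n) + ln (F_root (x i)) + \<delta>"
      using ln_fact_bounds(1)[OF n] n F_root_lower(2)[OF pos[OF i]]
      by (intro add_mono mult_left_mono order_refl) (auto simp: field_simps)
    finally show ?thesis .
  qed
  have "per d n A \<le> exp (\<Sum>i=1..n. (\<Sum>u=1..m. ln (Y i u)) / real m)"
    unfolding Y_def by (rule per_le_exp[OF A d n m])
  also have "\<dots> \<le> exp (\<Sum>i=1..n. real (d - 2) * (ln (fact n) / real n) + ln (F_root (x i)) + \<delta>)"
    by (intro exp_mono sum_mono row)
  also have "\<dots> = exp (real (d - 2) * ln (fact n) + (\<Sum>i=1..n. ln (F_root (x i))) + \<delta> * real n)"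
    using n by (simp add: sum.distrib mult.commute)
  also have "\<dots> = fact n ^ (d - 2) * (\<Prod>i=1..n. F_root (x i)) * exp (\<delta> * real n)"
    using F_root_lower(1)[OF pos] by (simp add: exp_add exp_of_nat_mult exp_sum)
  finally show ?thesis .
qed

theorem theorem4:
  fixes d :: nat and r :: "nat \<Rightarrow> nat \<Rightarrow> int"
  assumes "d \<ge> 2"
    and "filterlim (\<lambda>n. Min ((\<lambda>i. real_of_int (r n i) / real n ^ (d - 2)) ` {1..n}))
           at_top sequentially"
  shows "\<exists>\<epsilon> :: nat \<Rightarrow> real. \<epsilon> \<longlonglongrightarrow> 0 \<and>
     (\<forall>\<^sub>F n in sequentially.
        Max (per d n ` Lambda d n (r n)) \<le>
          fact n ^ (d - 2) * exp (\<epsilon> n * real n) *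
          (\<Prod>i=1..n. F_root (real_of_int (r n i) / real n ^ (d - 2))))"
proof -
  define x where "x = (\<lambda>n i. real_of_int (r n i) / real n ^ (d - 2))"
  define L where "L = (\<lambda>n. Max (per d n ` Lambda d n (r n)))"
  define G where "G = (\<lambda>n. fact n ^ (d - 2) * (\<Prod>i=1..n. F_root (x n i)))"
  have x_large: "\<forall>\<^sub>F n in sequentially. n \<ge> 1 \<and> (\<forall>i\<in>{1..n}. x n i \<ge> X)" for X
  proof -
    have "\<forall>\<^sub>F n in sequentially. X \<le> Min (x n ` {1..n})"
      using assms(2) unfolding x_def filterlim_at_top by blast
    then show ?thesis
      using eventually_ge_at_top[of 1] by eventually_elim auto
  qed
  have "\<exists>\<epsilon>. \<epsilon> \<longlonglongrightarrow> 0 \<and> (\<forall>\<^sub>F n in sequentially. L n \<le> G n * exp (\<epsilon> n * real n))"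
  proof (rule exists_vanishing_exponent)
    show "\<forall>\<^sub>F n in sequentially. G n > 0"
      using x_large[of 1]
    proof eventually_elim
      case (elim n)
      then have "F_root (x n i) > 0" if "i \<in> {1..n}" for i
        using that F_root_lower(1)[of "x n i"] by force
      then show ?case unfolding G_def by (intro mult_pos_pos prod_pos) auto
    qed
    fix \<delta> :: real assume "\<delta> > 0"
    \<comment> \<open>Order of choices: \<open>\<delta>\<close> determines \<open>m\<close>, then
      the threshold \<open>X\<close>, and only then is \<open>n\<close> taken large.\<close>
    obtain m :: nat where m: "m \<ge> 1" and "\<forall>\<^sub>F x in at_top.
        (\<Sum>u=1..m. ln ((real u / real m) ^ (d - 1) + real d ^ 2 / x)) / real m \<le> \<delta> - real (d - 1)"
      using eventually_mean_ln_le[OF \<open>\<delta> > 0\<close>] .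
    then obtain X where X: "\<And>x. x \<ge> X \<Longrightarrow>
        (\<Sum>u=1..m. ln ((real u / real m) ^ (d - 1) + real d ^ 2 / x)) / real m \<le> \<delta> - real (d - 1)"
      by (auto simp: eventually_at_top_linorder)
    show "\<forall>\<^sub>F n in sequentially. L n \<le> G n * exp (\<delta> * real n)"
      using x_large[of "max X 1"]
    proof eventually_elim
      case (elim n)
      then have xn: "x n i \<ge> X" "x n i > 0" if "i \<in> {1..n}" for i
        using that by force+
      have n: "n \<ge> 1" using elim by simp
      \<comment> \<open>Nonnegative bounds make \<open>Lambda\<close> nonempty, so
        \<open>Max\<close> is an actual maximum.\<close>
      have "r n i \<ge> 0" if "i \<in> {1..n}" for i
        using xn(2)[OF that] n by (simp add: x_def zero_less_divide_iff)
      then have "Lambda d n (r n) \<noteq> {}" by (rule Lambda_nonempty)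
      moreover have "per d n A \<le> G n * exp (\<delta> * real n)" if "A \<in> Lambda d n (r n)" for A
        unfolding G_def using xn
        by (intro per_le[OF that assms(1) n m] X) (auto simp: x_def)
      ultimately show ?case
        unfolding L_def using finite_Lambda by (intro Max.boundedI) auto
    qed
  qed
  then show ?thesis by (simp add: L_def G_def x_def mult_ac)
qed

end
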